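(* Let $\mathcal{H}$ be a separable Hilbert space over $\mathbb{F}$ with orthonormal basis $F=\{\phi^{(j)}\}_{j\in\mathbb{Z}}$, equipped with the product $\star_F$ determined by $F$. Then for any $x\in\mathcal{H}$ the operator $T_x:\mathcal{H}\to\mathcal{H}$ defined by $T_x(y)=x\star_F y$ for all $y\in\mathcal{H}$ is a Hilbert–Schmidt operator, and $\|T_x\|_{\mathrm{HS}}=\|x\|_{\mathcal{H}}$. As a corollary, if $\mathcal{H}$ is infinite dimensional, then there is no element $e\in\mathcal{H}$ such that $e\star_F x=x$ for all $x\in\mathcal{H}$.
   Context: $\mathbb{F}$ is $\mathbb{R}$ or $\mathbb{C}$. For $x\in\mathcal{H}$ write $\widehat{x}_j=\langle x,\phi^{(j)}\rangle_{\mathcal{H}}$, $j\in\mathbb{Z}$ (inner product linear in the first argument), so $\widehat{x}=(\widehat{x}_j)_{j\in\mathbb{Z}}\in\ell_2(\mathbb{Z})$. The product is $x\star_F y=\sum_{j\in\mathbb{Z}}\widehat{x}_j\widehat{y}_j\,\phi^{(j)}\in\mathcal{H}$. Infinite sums are unordered sums. *)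

theory Defs
  imports "HOL-Analysis.Analysis"
begin

text \<open>
  The scalar field is \<open>\<real>\<close> or \<open>\<complex>\<close>. The class below has, up to isometric isomorphism, exactly these
  two members: expanding \<open>norm (z + 1)\<^sup>2 = (z + 1) * (rc_cnj z + 1)\<close> shows that \<open>z + rc_cnj z\<close> is real,
  and \<open>z * rc_cnj z\<close> is real, so every \<open>z\<close> is a root of a real quadratic and the field is algebraic
  over \<open>\<real>\<close>. The operation \<open>rc_cnj\<close> is forced: the identity on \<open>\<real>\<close>, complex conjugation on \<open>\<complex>\<close>.
\<close>

class real_or_complex = real_normed_field +
  fixes rc_cnj :: "'a \<Rightarrow> 'a"
  assumes rc_cnj_add: "rc_cnj (a + b) = rc_cnj a + rc_cnj b"
    and rc_cnj_mult: "rc_cnj (a * b) = rc_cnj a * rc_cnj b"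
    and mult_rc_cnj: "a * rc_cnj a = (norm a)\<^sup>2 *\<^sub>R 1"

instantiation real :: real_or_complex
begin
definition rc_cnj_real :: "real \<Rightarrow> real" where "rc_cnj_real a = a"
instance by standard (auto simp: rc_cnj_real_def power2_eq_square)
end

instantiation complex :: real_or_complex
begin
definition rc_cnj_complex :: "complex \<Rightarrow> complex" where "rc_cnj_complex = cnj"
instance by standard (auto simp: rc_cnj_complex_def scaleR_conv_of_real complex_norm_square simp del: of_real_power)
end

text \<open>
  A Hilbert space over \<open>'f\<close>: the norm, the topology and completeness come from the underlying
  real Banach space; the locale adds the \<open>'f\<close>-scalar multiplication extending the real one and the
  inner product (linear in the first argument) inducing the norm. Positive definiteness of \<open>ip\<close>
  follows from \<open>ip_norm\<close>.
\<close>

locale hilbert_space = vector_space smul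
  for smul :: "'f::real_or_complex \<Rightarrow> 'h::banach \<Rightarrow> 'h" +
  fixes ip :: "'h \<Rightarrow> 'h \<Rightarrow> 'f"
  assumes scale_of_real: "smul (of_real r) x = r *\<^sub>R x"
    and ip_add_left: "ip (x + y) z = ip x z + ip y z"
    and ip_scale_left: "ip (smul a x) y = a * ip x y"
    and ip_commute: "ip x y = rc_cnj (ip y x)"
    and ip_norm: "ip x x = of_real ((norm x)\<^sup>2)"

lemma hilbert_space_real:
  "hilbert_space scaleR (inner :: 'h::{real_inner,banach} \<Rightarrow> 'h \<Rightarrow> real)"
  by unfold_locales
    (auto simp: algebra_simps inner_commute rc_cnj_real_def power2_norm_eq_inner)

lemma hilbert_space_complex: "hilbert_space (*) (\<lambda>x y :: complex. x * cnj y)"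
  by unfold_locales
    (auto simp: algebra_simps scaleR_conv_of_real rc_cnj_complex_def complex_norm_square
      simp del: of_real_power)

definition orthonormal_basis ::
    "('f::real_or_complex \<Rightarrow> 'h::banach \<Rightarrow> 'h) \<Rightarrow> ('h \<Rightarrow> 'h \<Rightarrow> 'f) \<Rightarrow> 'i set \<Rightarrow> ('i \<Rightarrow> 'h) \<Rightarrow> bool" where
  "orthonormal_basis smul ip I \<phi> \<longleftrightarrow>
     (\<forall>i\<in>I. \<forall>j\<in>I. ip (\<phi> i) (\<phi> j) = (if i = j then 1 else 0)) \<and>
     closure (module.span smul (\<phi> ` I)) = UNIV"

definition basis_product ::
    "('f::real_or_complex \<Rightarrow> 'h::banach \<Rightarrow> 'h) \<Rightarrow> ('h \<Rightarrow> 'h \<Rightarrow> 'f) \<Rightarrow> (int \<Rightarrow> 'h) \<Rightarrow> 'h \<Rightarrow> 'h \<Rightarrow> 'h" where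
  "basis_product smul ip \<phi> x y = (\<Sum>\<^sub>\<infinity>j\<in>UNIV. smul (ip x (\<phi> j) * ip y (\<phi> j)) (\<phi> j))"

definition bounded_operator ::
    "('f::real_or_complex \<Rightarrow> 'h::banach \<Rightarrow> 'h) \<Rightarrow> ('h \<Rightarrow> 'h) \<Rightarrow> bool" where
  "bounded_operator smul T \<longleftrightarrow>
     Vector_Spaces.linear smul smul T \<and> (\<exists>K. \<forall>x. norm (T x) \<le> K * norm x)"

text \<open>
  Orthonormal bases \<open>E\<close> in the next two definitions are sets of vectors, indexed by themselves, so
  they range over all orthonormal bases of the space. The Hilbert--Schmidt norm does not
  depend on the basis (Parseval), so it is evaluated at an arbitrarily chosen one.
\<close>

definition hilbert_schmidt ::
    "('f::real_or_complex \<Rightarrow> 'h::banach \<Rightarrow> 'h) \<Rightarrow> ('h \<Rightarrow> 'h \<Rightarrow> 'f) \<Rightarrow> ('h \<Rightarrow> 'h) \<Rightarrow> bool" where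
  "hilbert_schmidt smul ip T \<longleftrightarrow>
     bounded_operator smul T \<and>
     (\<forall>E. orthonormal_basis smul ip E (\<lambda>e. e) \<longrightarrow> (\<lambda>e. (norm (T e))\<^sup>2) summable_on E)"

definition hs_norm ::
    "('f::real_or_complex \<Rightarrow> 'h::banach \<Rightarrow> 'h) \<Rightarrow> ('h \<Rightarrow> 'h \<Rightarrow> 'f) \<Rightarrow> ('h \<Rightarrow> 'h) \<Rightarrow> real" where
  "hs_norm smul ip T =
     (let E = (SOME E. orthonormal_basis smul ip E (\<lambda>e. e))
      in sqrt (\<Sum>\<^sub>\<infinity>e\<in>E. (norm (T e))\<^sup>2))"

definition infinite_dimensional :: "('f::real_or_complex \<Rightarrow> 'h::banach \<Rightarrow> 'h) \<Rightarrow> bool" where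
  "infinite_dimensional smul \<longleftrightarrow> \<not> (\<exists>B. finite B \<and> module.span smul B = UNIV)"

end

theory Submission
  imports Defs
begin

text \<open>
  Parseval's identity holds for every orthonormal basis \<open>E\<close>, so exchanging the order of summation
  of nonnegative terms gives
  \<open>\<Sum>\<^sub>e \<parallel>T\<^sub>x e\<parallel>\<^sup>2 = \<Sum>\<^sub>e \<Sum>\<^sub>j \<bar>x\<^sub>j\<bar>\<^sup>2 \<bar>\<langle>e, \<phi>\<^sub>j\<rangle>\<bar>\<^sup>2 = \<Sum>\<^sub>j \<bar>x\<^sub>j\<bar>\<^sup>2 \<parallel>\<phi>\<^sub>j\<parallel>\<^sup>2 = \<parallel>x\<parallel>\<^sup>2\<close>.
  All coefficients of a unit for the product would be \<open>1\<close>, which is not square summable.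
\<close>

section \<open>Conjugation in the scalar field\<close>

lemma rc_cnj_0: "rc_cnj (0::'f::real_or_complex) = 0"
  using rc_cnj_add[of "0::'f" 0] by simp

lemma norm_rc_cnj: "norm (rc_cnj a) = norm (a::'f::real_or_complex)"
proof (cases "a = 0")
  case False
  have "norm a * norm (rc_cnj a) = norm a * norm a"
    using arg_cong[OF mult_rc_cnj[of a], of norm] by (simp add: norm_mult power2_eq_square)
  then show ?thesis
    using False by simp
qed (simp add: rc_cnj_0)

lemma mult_rc_cnj_of_real: "a * rc_cnj a = of_real ((norm (a::'f::real_or_complex))\<^sup>2)"
  by (simp only: mult_rc_cnj of_real_def)

text \<open>The orthonormality half of \<open>orthonormal_basis\<close>: unlike totality it passes
  to subfamilies, and the finite computations below live in finite subfamilies.\<close>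

definition orthonormal_family ::
    "('h \<Rightarrow> 'h \<Rightarrow> 'f::zero_neq_one) \<Rightarrow> 'i set \<Rightarrow> ('i \<Rightarrow> 'h) \<Rightarrow> bool" where
  "orthonormal_family ip I \<phi> \<longleftrightarrow> (\<forall>i\<in>I. \<forall>j\<in>I. ip (\<phi> i) (\<phi> j) = (if i = j then 1 else 0))"

lemma orthonormal_basis_imp_family:
  "orthonormal_basis smul ip I \<phi> \<Longrightarrow> orthonormal_family ip I \<phi>"
  by (simp add: orthonormal_basis_def orthonormal_family_def)

lemma orthonormal_family_mono:
  "orthonormal_family ip I \<phi> \<Longrightarrow> J \<subseteq> I \<Longrightarrow> orthonormal_family ip J \<phi>"
  unfolding orthonormal_family_def by blast

context hilbert_space
begin

section \<open>Algebra of the inner product and the norm\<close>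

lemma ip_zero_left: "ip 0 y = 0"
  using ip_add_left[of 0 0 y] by simp

lemma ip_zero_right: "ip x 0 = 0"
  using ip_commute[of x 0] by (simp add: ip_zero_left rc_cnj_0)

lemma ip_add_right: "ip x (y + z) = ip x y + ip x z"
  by (metis ip_add_left ip_commute rc_cnj_add)

lemma ip_scale_right: "ip x (smul a y) = rc_cnj a * ip x y"
  by (metis ip_scale_left ip_commute rc_cnj_mult)

lemma ip_diff_left: "ip (x - y) z = ip x z - ip y z"
  using ip_add_left[of "x - y" y z] by simp

lemma ip_sum_left: "ip (sum f A) y = (\<Sum>a\<in>A. ip (f a) y)"
  by (induction A rule: infinite_finite_induct) (auto simp: ip_zero_left ip_add_left)

lemma ip_sum_right: "ip x (sum f A) = (\<Sum>a\<in>A. ip x (f a))"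
  by (induction A rule: infinite_finite_induct) (auto simp: ip_zero_right ip_add_right)

text \<open>The Banach structure gives homogeneity only for real scalars; for scalars in
  \<open>'f\<close> it comes from \<open>ip_norm\<close>, by comparing squares inside
  \<open>'f\<close> and cancelling the injective \<open>of_real\<close>.\<close>

lemma norm_smul: "norm (smul a x) = norm a * norm x"
proof -
  have "(of_real ((norm (smul a x))\<^sup>2) :: 'f) = a * rc_cnj a * ip x x"
    by (simp only: ip_norm[symmetric] ip_scale_left ip_scale_right mult.assoc mult.left_commute)
  also have "\<dots> = of_real ((norm a * norm x)\<^sup>2)"
    by (simp only: mult_rc_cnj_of_real ip_norm of_real_mult[symmetric] power_mult_distrib)
  finally have "(norm (smul a x))\<^sup>2 = (norm a * norm x)\<^sup>2"
    by (simp only: of_real_eq_iff)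
  then show ?thesis
    by (simp add: power2_eq_iff_nonneg)
qed

lemma norm_add_orthogonal:
  assumes "ip x y = 0"
  shows "(norm (x + y))\<^sup>2 = (norm x)\<^sup>2 + (norm y)\<^sup>2"
proof -
  have "ip y x = 0"
    using ip_commute[of y x] assms by (simp add: rc_cnj_0)
  then have "(of_real ((norm (x + y))\<^sup>2) :: 'f) = of_real ((norm x)\<^sup>2 + (norm y)\<^sup>2)"
    unfolding of_real_add ip_norm[symmetric] using assms by (simp add: ip_add_left ip_add_right)
  then show ?thesis
    by (simp only: of_real_eq_iff)
qed

lemma bounded_linear_smul: "bounded_linear (smul a)"
proof (rule bounded_linear_intro[where K = "norm a"])
  fix r x
  show "smul a (r *\<^sub>R x) = r *\<^sub>R smul a x"
    by (simp add: scale_of_real[symmetric] scale_left_commute)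
qed (simp_all add: norm_smul scale_right_distrib mult.commute)

section \<open>Finite expansions as orthogonal projections\<close>

definition partial_expansion :: "('i \<Rightarrow> 'h) \<Rightarrow> 'i set \<Rightarrow> 'h \<Rightarrow> 'h" where
  "partial_expansion \<phi> F x = (\<Sum>i\<in>F. smul (ip x (\<phi> i)) (\<phi> i))"

lemma ip_combination:
  assumes "orthonormal_family ip F \<phi>" "finite F" "j \<in> F"
  shows "ip (\<Sum>i\<in>F. smul (c i) (\<phi> i)) (\<phi> j) = c j"
proof -
  have "ip (\<Sum>i\<in>F. smul (c i) (\<phi> i)) (\<phi> j) = (\<Sum>i\<in>F. if i = j then c i else 0)"
    unfolding ip_sum_left ip_scale_left
    using assms by (intro sum.cong) (auto simp: orthonormal_family_def)
  then show ?thesis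
    using assms by simp
qed

lemma norm_combination:
  assumes "orthonormal_family ip F \<phi>" "finite F"
  shows "(norm (\<Sum>i\<in>F. smul (c i) (\<phi> i)))\<^sup>2 = (\<Sum>i\<in>F. (norm (c i))\<^sup>2)"
proof -
  let ?s = "\<Sum>i\<in>F. smul (c i) (\<phi> i)"
  have "(of_real ((norm ?s)\<^sup>2) :: 'f) = (\<Sum>i\<in>F. rc_cnj (c i) * ip ?s (\<phi> i))"
    by (simp only: ip_norm[symmetric] ip_sum_right ip_scale_right)
  also have "\<dots> = (\<Sum>i\<in>F. of_real ((norm (c i))\<^sup>2))"
    by (intro sum.cong refl)
      (simp only: ip_combination[OF assms] mult_rc_cnj_of_real[symmetric] mult.commute)
  finally show ?thesis
    by (simp only: of_real_sum[symmetric] of_real_eq_iff)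
qed

text \<open>Pythagoras for the orthogonal projection onto the span of finitely many orthonormal
  vectors. Keeping the residual, instead of weakening to Bessel's inequality, lets Parseval follow
  once the residual tends to 0.\<close>

lemma norm_partial_expansion:
  assumes "orthonormal_family ip F \<phi>" "finite F"
  shows "(\<Sum>i\<in>F. (norm (ip x (\<phi> i)))\<^sup>2) + (norm (x - partial_expansion \<phi> F x))\<^sup>2 = (norm x)\<^sup>2"
proof -
  let ?P = "partial_expansion \<phi> F x"
  have "ip (x - ?P) (\<phi> i) = 0" if "i \<in> F" for i
    unfolding partial_expansion_def using ip_combination[OF assms that] by (simp add: ip_diff_left)
  then have "ip (x - ?P) ?P = 0"
    \<comment> \<open>Only the right argument is expanded; the residual on the left stays intact and
      is orthogonal to each term.\<close>
    by (subst (2) partial_expansion_def) (simp add: ip_sum_right ip_scale_right)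
  from norm_add_orthogonal[OF this]
  have "(norm x)\<^sup>2 = (norm ?P)\<^sup>2 + (norm (x - ?P))\<^sup>2"
    by simp
  also have "(norm ?P)\<^sup>2 = (\<Sum>i\<in>F. (norm (ip x (\<phi> i)))\<^sup>2)"
    unfolding partial_expansion_def by (rule norm_combination[OF assms])
  finally show ?thesis
    by simp
qed

text \<open>The one-vector case of the Pythagoras identity; it serves as Cauchy-Schwarz against a
  unit vector and makes coefficient functionals continuous.\<close>

lemma norm_ip_le:
  assumes "orthonormal_family ip I \<phi>" "i \<in> I"
  shows "norm (ip x (\<phi> i)) \<le> norm x"
proof -
  have "orthonormal_family ip {i} \<phi>"
    using orthonormal_family_mono[OF assms(1)] assms(2) by simp
  then have "(norm (ip x (\<phi> i)))\<^sup>2 + (norm (x - partial_expansion \<phi> {i} x))\<^sup>2 = (norm x)\<^sup>2"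
    using norm_partial_expansion[of "{i}" \<phi> x] by simp
  then have "(norm (ip x (\<phi> i)))\<^sup>2 \<le> (norm x)\<^sup>2"
    by (smt (verit) zero_le_power2)
  then show ?thesis
    by (rule power2_le_imp_le) simp
qed

lemma bounded_linear_ip:
  assumes "orthonormal_family ip I \<phi>" "i \<in> I"
  shows "bounded_linear (\<lambda>x. ip x (\<phi> i))"
proof (rule bounded_linear_intro[where K = 1])
  fix r x
  show "ip (r *\<^sub>R x) (\<phi> i) = r *\<^sub>R ip x (\<phi> i)"
    by (simp add: scale_of_real[symmetric] scaleR_conv_of_real ip_scale_left)
qed (simp_all add: ip_add_left norm_ip_le[OF assms])

lemma norm_orthonormal:
  assumes "orthonormal_family ip I \<phi>" "i \<in> I"
  shows "norm (\<phi> i) = 1"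
proof -
  have "(of_real ((norm (\<phi> i))\<^sup>2) :: 'f) = of_real 1"
    unfolding ip_norm[symmetric] using assms by (simp add: orthonormal_family_def)
  then have "(norm (\<phi> i))\<^sup>2 = 1"
    by (simp only: of_real_eq_iff)
  then show ?thesis
    using power2_eq_iff_nonneg[of "norm (\<phi> i)" 1] by simp
qed

section \<open>Convergence of expansions and Parseval's identity\<close>

lemma span_partial_expansion:
  assumes on: "orthonormal_family ip I \<phi>" and s: "s \<in> span (\<phi> ` I)"
  shows "\<exists>F. finite F \<and> F \<subseteq> I \<and>
      (\<forall>G. finite G \<and> F \<subseteq> G \<and> G \<subseteq> I \<longrightarrow> partial_expansion \<phi> G s = s)"
  using s
proof (induction s rule: span_induct_alt)
  case base
  show ?case
    by (intro exI[of _ "{}"]) (simp add: partial_expansion_def ip_zero_left)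
next
  case (step c b s)
  then obtain i F where i: "i \<in> I" "b = \<phi> i" and F: "finite F" "F \<subseteq> I"
    "\<And>G. finite G \<Longrightarrow> F \<subseteq> G \<Longrightarrow> G \<subseteq> I \<Longrightarrow> partial_expansion \<phi> G s = s"
    by auto
  \<comment> \<open>Adding the index of the new vector to \<open>F\<close> suffices: the induction
    hypothesis covers every larger \<open>G\<close>, and on \<open>b\<close> only the term
    \<open>k = i\<close> survives.\<close>
  have "partial_expansion \<phi> G (smul c b + s) = smul c b + s"
    if G: "finite G" "insert i F \<subseteq> G" "G \<subseteq> I" for G
  proof -
    have "(\<Sum>k\<in>G. smul (ip b (\<phi> k)) (\<phi> k)) = (\<Sum>k\<in>G. if k = i then b else 0)"
      using on i G by (intro sum.cong) (auto simp: orthonormal_family_def subset_iff)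
    then have "partial_expansion \<phi> G b = b"
      using G by (simp add: partial_expansion_def)
    moreover have "partial_expansion \<phi> G (smul c b + s) =
        smul c (partial_expansion \<phi> G b) + partial_expansion \<phi> G s"
      unfolding partial_expansion_def
      by (simp add: ip_add_left ip_scale_left scale_left_distrib sum.distrib scale_sum_right)
    ultimately show ?thesis
      using F(3)[of G] G by simp
  qed
  then show ?case
    using i F by (intro exI[of _ "insert i F"]) auto
qed

text \<open>Density gives \<open>s\<close> in the span close to \<open>x\<close>. Large
  \<open>G\<close> reproduce \<open>s\<close> exactly, so the residual of \<open>x\<close> equals
  that of \<open>x - s\<close>, which Pythagoras bounds by \<open>norm (x - s)\<close>.\<close>

lemma partial_expansion_tendsto:
  assumes "orthonormal_basis smul ip I \<phi>"
  shows "((\<lambda>F. partial_expansion \<phi> F x) \<longlongrightarrow> x) (finite_subsets_at_top I)"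
proof (rule tendstoI)
  fix e :: real
  assume "e > 0"
  have on: "orthonormal_family ip I \<phi>"
    using assms by (rule orthonormal_basis_imp_family)
  have "x \<in> closure (span (\<phi> ` I))"
    using assms by (simp add: orthonormal_basis_def)
  then obtain s where s: "s \<in> span (\<phi> ` I)" "dist s x < e"
    using \<open>e > 0\<close> unfolding closure_approachable by blast
  obtain F where F: "finite F" "F \<subseteq> I"
    "\<forall>G. finite G \<and> F \<subseteq> G \<and> G \<subseteq> I \<longrightarrow> partial_expansion \<phi> G s = s"
    using span_partial_expansion[OF on s(1)] by blast
  have "dist (partial_expansion \<phi> G x) x < e" if G: "finite G" "F \<subseteq> G" "G \<subseteq> I" for G
  proof -
    have "partial_expansion \<phi> G (x - s) = partial_expansion \<phi> G x - partial_expansion \<phi> G s"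
      unfolding partial_expansion_def
      by (simp add: ip_diff_left scale_left_diff_distrib sum_subtractf)
    then have res: "(x - s) - partial_expansion \<phi> G (x - s) = x - partial_expansion \<phi> G x"
      using F(3) G by simp
    have "(norm (x - partial_expansion \<phi> G x))\<^sup>2 \<le> (norm (x - s))\<^sup>2"
      using norm_partial_expansion[OF orthonormal_family_mono[OF on G(3)] G(1), of "x - s"]
        sum_nonneg[of G "\<lambda>i. (norm (ip (x - s) (\<phi> i)))\<^sup>2", OF zero_le_power2]
      unfolding res by linarith
    then have "norm (x - partial_expansion \<phi> G x) \<le> norm (x - s)"
      by (rule power2_le_imp_le) simp
    then show ?thesis
      using s(2) by (simp add: dist_norm norm_minus_commute)
  qed
  then show "\<forall>\<^sub>F G in finite_subsets_at_top I. dist (partial_expansion \<phi> G x) x < e"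
    unfolding eventually_finite_subsets_at_top using F(1,2) by (intro exI[of _ F]) simp
qed

lemma has_sum_parseval:
  assumes "orthonormal_basis smul ip I \<phi>"
  shows "((\<lambda>i. (norm (ip x (\<phi> i)))\<^sup>2) has_sum (norm x)\<^sup>2) I"
proof -
  have on: "orthonormal_family ip I \<phi>"
    using assms by (rule orthonormal_basis_imp_family)
  \<comment> \<open>By Pythagoras this expression is the partial sum over \<open>F\<close>; the
    limit is left as \<open>norm (x - x)\<close> to match the limit rules.\<close>
  have lim: "((\<lambda>F. (norm x)\<^sup>2 - (norm (x - partial_expansion \<phi> F x))\<^sup>2) \<longlongrightarrow>
      (norm x)\<^sup>2 - (norm (x - x))\<^sup>2) (finite_subsets_at_top I)"
    by (intro tendsto_intros partial_expansion_tendsto[OF assms])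
  have eq: "\<forall>\<^sub>F F in finite_subsets_at_top I.
      (norm x)\<^sup>2 - (norm (x - partial_expansion \<phi> F x))\<^sup>2 = (\<Sum>i\<in>F. (norm (ip x (\<phi> i)))\<^sup>2)"
  proof (rule eventually_finite_subsets_at_top_weakI)
    fix F
    assume "finite F" "F \<subseteq> I"
    then show "(norm x)\<^sup>2 - (norm (x - partial_expansion \<phi> F x))\<^sup>2 = (\<Sum>i\<in>F. (norm (ip x (\<phi> i)))\<^sup>2)"
      using norm_partial_expansion[OF orthonormal_family_mono[OF on], of F x] by simp
  qed
  show ?thesis
    using lim unfolding tendsto_cong[OF eq] has_sum_def by simp
qed

lemma norm_ip_commute: "norm (ip x y) = norm (ip y x)"
  by (subst ip_commute) (rule norm_rc_cnj)

section \<open>The product: convergence, coefficients and boundedness\<close>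

text \<open>An \<open>infsum\<close> is 0 by default when the family is not summable, so convergence
  must be secured first: the terms are dominated by the sum of the squared coefficients of
  \<open>x\<close> and \<open>y\<close>.\<close>

lemma has_sum_basis_product:
  assumes basis: "orthonormal_basis smul ip UNIV \<phi>"
  shows "((\<lambda>j. smul (ip x (\<phi> j) * ip y (\<phi> j)) (\<phi> j)) has_sum basis_product smul ip \<phi> x y) UNIV"
proof -
  have on: "orthonormal_family ip UNIV \<phi>"
    using basis by (rule orthonormal_basis_imp_family)
  have "(\<lambda>j. (norm (ip x (\<phi> j)))\<^sup>2 + (norm (ip y (\<phi> j)))\<^sup>2) summable_on UNIV"
    using has_sum_parseval[OF basis] by (intro summable_on_add has_sum_imp_summable)
  then have "(\<lambda>j. smul (ip x (\<phi> j) * ip y (\<phi> j)) (\<phi> j)) abs_summable_on UNIV"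
  proof (rule summable_on_comparison_test)
    fix j
    have "0 \<le> norm (ip x (\<phi> j)) * norm (ip y (\<phi> j))"
      by simp
    moreover have "2 * norm (ip x (\<phi> j)) * norm (ip y (\<phi> j))
        \<le> (norm (ip x (\<phi> j)))\<^sup>2 + (norm (ip y (\<phi> j)))\<^sup>2"
      by (rule sum_squares_bound)
    ultimately show "norm (smul (ip x (\<phi> j) * ip y (\<phi> j)) (\<phi> j))
        \<le> (norm (ip x (\<phi> j)))\<^sup>2 + (norm (ip y (\<phi> j)))\<^sup>2"
      unfolding norm_smul norm_orthonormal[OF on UNIV_I] norm_mult by linarith
  qed simp
  then show ?thesis
    unfolding basis_product_def by (rule has_sum_infsum[OF abs_summable_summable])
qed

text \<open>A continuous coefficient functional may be applied termwise to the sum, where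
  orthonormality leaves only \<open>j = k\<close>.\<close>

lemma ip_basis_product:
  assumes basis: "orthonormal_basis smul ip UNIV \<phi>"
  shows "ip (basis_product smul ip \<phi> x y) (\<phi> k) = ip x (\<phi> k) * ip y (\<phi> k)"
proof -
  have on: "orthonormal_family ip UNIV \<phi>"
    using basis by (rule orthonormal_basis_imp_family)
  have "((\<lambda>j. ip (smul (ip x (\<phi> j) * ip y (\<phi> j)) (\<phi> j)) (\<phi> k)) has_sum
      ip (basis_product smul ip \<phi> x y) (\<phi> k)) UNIV"
    using has_sum_bounded_linear[OF bounded_linear_ip[OF on UNIV_I] has_sum_basis_product[OF basis]] .
  moreover have "((\<lambda>j. ip (smul (ip x (\<phi> j) * ip y (\<phi> j)) (\<phi> j)) (\<phi> k)) has_sum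
      ip x (\<phi> k) * ip y (\<phi> k)) UNIV"
    using on by (intro has_sum_finite_neutralI[of "{k}"])
      (auto simp: ip_scale_left orthonormal_family_def)
  ultimately show ?thesis
    by (rule has_sum_unique)
qed

lemma has_sum_norm_basis_product:
  assumes "orthonormal_basis smul ip UNIV \<phi>"
  shows "((\<lambda>j. (norm (ip x (\<phi> j)))\<^sup>2 * (norm (ip y (\<phi> j)))\<^sup>2) has_sum
      (norm (basis_product smul ip \<phi> x y))\<^sup>2) UNIV"
  using has_sum_parseval[OF assms, of "basis_product smul ip \<phi> x y"]
  by (simp add: ip_basis_product[OF assms] norm_mult power_mult_distrib)

text \<open>Bounding each coefficient of \<open>y\<close> by \<open>norm y\<close> in Parseval's sum
  for the product leaves Parseval's sum for \<open>x\<close>. This supplies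
  \<open>K = norm x\<close> for boundedness.\<close>

lemma norm_basis_product_le:
  assumes basis: "orthonormal_basis smul ip UNIV \<phi>"
  shows "norm (basis_product smul ip \<phi> x y) \<le> norm x * norm y"
proof -
  have "(norm (basis_product smul ip \<phi> x y))\<^sup>2 \<le> (norm x)\<^sup>2 * (norm y)\<^sup>2"
  proof (rule has_sum_mono[OF has_sum_norm_basis_product[OF basis]
        has_sum_cmult_left[OF has_sum_parseval[OF basis]]])
    fix j
    have "norm (ip y (\<phi> j)) \<le> norm y"
      using basis by (intro norm_ip_le orthonormal_basis_imp_family) auto
    then show "(norm (ip x (\<phi> j)))\<^sup>2 * (norm (ip y (\<phi> j)))\<^sup>2 \<le> (norm (ip x (\<phi> j)))\<^sup>2 * (norm y)\<^sup>2"
      by (intro mult_left_mono power_mono) auto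
  qed
  then have "(norm (basis_product smul ip \<phi> x y))\<^sup>2 \<le> (norm x * norm y)\<^sup>2"
    by (simp only: power_mult_distrib)
  then show ?thesis
    by (rule power2_le_imp_le) simp
qed

text \<open>For linearity, both sides are sums of the same family, and sums are unique;
  \<open>bounded_linear_smul\<close> moves a scalar through the infinite sum.\<close>

lemma bounded_operator_basis_product:
  assumes basis: "orthonormal_basis smul ip UNIV \<phi>"
  shows "bounded_operator smul (\<lambda>y. basis_product smul ip \<phi> x y)"
proof -
  note hs = has_sum_basis_product[OF basis]
  have "basis_product smul ip \<phi> x (y + z) = basis_product smul ip \<phi> x y + basis_product smul ip \<phi> x z"
    for y z
    using has_sum_add[OF hs[of x y] hs[of x z]]
    by (intro has_sum_unique[OF hs[of x "y + z"]])
      (simp add: ip_add_left distrib_left scale_left_distrib)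
  moreover have "basis_product smul ip \<phi> x (smul a y) = smul a (basis_product smul ip \<phi> x y)" for a y
    using has_sum_bounded_linear[OF bounded_linear_smul hs[of x y], of a]
    by (intro has_sum_unique[OF hs[of x "smul a y"]]) (simp add: ip_scale_left mult.left_commute)
  ultimately have "Vector_Spaces.linear smul smul (\<lambda>y. basis_product smul ip \<phi> x y)"
    unfolding Vector_Spaces.linear_iff using vector_space_axioms by auto
  then show ?thesis
    unfolding bounded_operator_def using norm_basis_product_le[OF basis] by blast
qed

section \<open>The Hilbert-Schmidt norm\<close>

lemma has_sum_hs_basis_product:
  assumes basis: "orthonormal_basis smul ip UNIV \<phi>"
    and E: "orthonormal_basis smul ip E (\<lambda>e. e)"
  shows "((\<lambda>e. (norm (basis_product smul ip \<phi> x e))\<^sup>2) has_sum (norm x)\<^sup>2) E"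
proof -
  define f where "f = (\<lambda>(j, e). (norm (ip x (\<phi> j)))\<^sup>2 * (norm (ip e (\<phi> j)))\<^sup>2)"
  have on: "orthonormal_family ip UNIV \<phi>"
    using basis by (rule orthonormal_basis_imp_family)
  \<comment> \<open>Parseval for the unit vector \<open>\<phi> j\<close> in the basis
    \<open>E\<close>; its coefficients have the same modulus as those of \<open>e\<close> against
    \<open>\<phi> j\<close>.\<close>
  have inner: "((\<lambda>e. f (j, e)) has_sum (norm (ip x (\<phi> j)))\<^sup>2) E" for j
    using has_sum_cmult_right[OF has_sum_parseval[OF E, of "\<phi> j"], of "(norm (ip x (\<phi> j)))\<^sup>2"]
    by (simp add: f_def norm_ip_commute[of "\<phi> j"] norm_orthonormal[OF on])
  have outer: "((\<lambda>j. (norm (ip x (\<phi> j)))\<^sup>2) has_sum (norm x)\<^sup>2) UNIV"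
    by (rule has_sum_parseval[OF basis])
  \<comment> \<open>Nonnegativity makes the convergent iterated sum a sum over pairs, which may then
    be regrouped with \<open>e\<close> outside; for fixed \<open>e\<close> the sum over
    \<open>j\<close> is Parseval for the product.\<close>
  have "f summable_on UNIV \<times> E"
    by (rule summable_on_SigmaI[OF inner has_sum_imp_summable[OF outer]]) (auto simp: f_def)
  then have "(f has_sum (norm x)\<^sup>2) (UNIV \<times> E)"
    by (rule has_sum_SigmaI[OF inner outer])
  then have "((\<lambda>(e, j). f (j, e)) has_sum (norm x)\<^sup>2) (E \<times> UNIV)"
    by (rule has_sum_swap[THEN iffD1])
  then show ?thesis
    by (rule has_sum_SigmaD) (simp add: f_def has_sum_norm_basis_product[OF basis])
qed

text \<open>Passes from an indexed basis to a self-indexed one, the form quantified over in the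
  Hilbert-Schmidt definitions; it guarantees that the choice in \<open>hs_norm\<close> picks a
  basis. Equal vectors at distinct indices would force \<open>1 = 0\<close>.\<close>

lemma orthonormal_basis_image:
  assumes basis: "orthonormal_basis smul ip I \<phi>"
  shows "orthonormal_basis smul ip (\<phi> ` I) (\<lambda>e. e)"
proof -
  have "inj_on \<phi> I"
    using basis unfolding orthonormal_basis_def inj_on_def by (metis zero_neq_one)
  then show ?thesis
    using basis by (auto simp: orthonormal_basis_def inj_on_eq_iff)
qed

lemma hs_norm_basis_product:
  assumes basis: "orthonormal_basis smul ip UNIV \<phi>"
  shows "hs_norm smul ip (\<lambda>y. basis_product smul ip \<phi> x y) = norm x"
proof -
  define E where "E = (SOME E. orthonormal_basis smul ip E (\<lambda>e. e))"
  have "orthonormal_basis smul ip E (\<lambda>e. e)"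
    unfolding E_def using orthonormal_basis_image[OF basis] by (rule someI)
  then have "(\<Sum>\<^sub>\<infinity>e\<in>E. (norm (basis_product smul ip \<phi> x e))\<^sup>2) = (norm x)\<^sup>2"
    by (intro infsumI has_sum_hs_basis_product[OF basis])
  then show ?thesis
    by (simp add: hs_norm_def E_def)
qed

lemma hilbert_schmidt_basis_product:
  assumes basis: "orthonormal_basis smul ip UNIV \<phi>"
  shows "hilbert_schmidt smul ip (\<lambda>y. basis_product smul ip \<phi> x y)"
  unfolding hilbert_schmidt_def
  using bounded_operator_basis_product[OF basis] has_sum_hs_basis_product[OF basis]
  by (auto intro: has_sum_imp_summable)

section \<open>Absence of a unit\<close>

lemma no_unit_basis_product:
  assumes basis: "orthonormal_basis smul ip UNIV \<phi>"
  shows "\<not> (\<exists>e. \<forall>x. basis_product smul ip \<phi> e x = x)"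
proof
  assume "\<exists>e. \<forall>x. basis_product smul ip \<phi> e x = x"
  then obtain e where e: "\<And>x. basis_product smul ip \<phi> e x = x"
    by blast
  \<comment> \<open>Compares the coefficients at \<open>j\<close> in the unit law applied to
    \<open>\<phi> j\<close>.\<close>
  have "ip e (\<phi> j) = 1" for j
    using ip_basis_product[OF basis, of e "\<phi> j" j] basis by (simp add: e orthonormal_basis_def)
  then have "((\<lambda>j::int. 1::real) has_sum (norm e)\<^sup>2) UNIV"
    using has_sum_parseval[OF basis, of e] by simp
  then have "(\<lambda>j::int. 1::real) summable_on UNIV"
    by (rule has_sum_imp_summable)
  then show False
    using infsum_diverge_constant[of "UNIV :: int set" "1::real"] by simp
qed

end

theorem lemma3p2:
  fixes smul :: "'f::real_or_complex \<Rightarrow> 'h::banach \<Rightarrow> 'h"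
    and ip :: "'h \<Rightarrow> 'h \<Rightarrow> 'f"
    and \<phi> :: "int \<Rightarrow> 'h"
  assumes "hilbert_space smul ip"
    and "separable_space (euclidean :: 'h topology)"
    and "orthonormal_basis smul ip UNIV \<phi>"
  shows "(\<forall>x. hilbert_schmidt smul ip (\<lambda>y. basis_product smul ip \<phi> x y) \<and>
              hs_norm smul ip (\<lambda>y. basis_product smul ip \<phi> x y) = norm x) \<and>
         (infinite_dimensional smul \<longrightarrow>
           \<not> (\<exists>e. \<forall>x. basis_product smul ip \<phi> e x = x))"
  using hilbert_space.hilbert_schmidt_basis_product[OF assms(1,3)]
    hilbert_space.hs_norm_basis_product[OF assms(1,3)]
    hilbert_space.no_unit_basis_product[OF assms(1,3)]
  by blast

end
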